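(* Let $p$ be an odd prime that is not a Mersenne prime, and let $q$ be any odd prime divisor of $p+1$. Define $$n=2pq,\quad i=p,\quad j=q,\quad k=p+q,\quad \ell=2p+1,\quad m=n-\ell=2pq-2p-1.$$ Then $n\ge 5$ and all of the following conditions hold: (i) $1<i,j,k<n$ and $i,j,k$ are pairwise coprime; (ii) $\gcd(x,n)>1$ for each $x\in\{i,j,k\}$; (iii) $\ell^2\equiv m^2\equiv 1\pmod n$, none of $\ell,m,\ell m$ is congruent to $1$ modulo $n$, $k\equiv j\ell+i\equiv im+j\pmod n$, and $i(\ell+1)\equiv j(m+1)\equiv 0\pmod n$. (That is, the subset $C=\{b,ba^i,ba^j,ba^k\}$ of the dihedral group $G=D_{2n}=\langle a,b\mid a^n=b^2=1,\ bab=a^{-1}\rangle$ belongs to the family of subsets $\{b,ba^i,ba^j,ba^k\}$ of dihedral groups $D_{2n}$, $n\geq5$, defined by conditions (i)--(iii).)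
   Context: A Mersenne prime is a prime of the form $2^r-1$ for some integer $r$. *)

theory Defs
  imports "HOL-Number_Theory.Cong" "HOL-Algebra.Generated_Groups"
begin

definition mersenne_prime :: "int \<Rightarrow> bool"
  where "mersenne_prime M \<longleftrightarrow> prime M \<and> (\<exists>r::nat. M = 2 ^ r - 1)"

text \<open>
  The dihedral group of order \<open>2 * n\<close>, for \<open>n > 0\<close>, in normal form: the pair \<open>(s, x)\<close> with
  \<open>0 \<le> x < n\<close> stands for \<open>b a\<^sup>x\<close> if \<open>s\<close> holds and for \<open>a\<^sup>x\<close> otherwise. The multiplication
  is dictated by \<open>a\<^sup>x b = b a\<^bsup>-x\<^esup>\<close>. The lemmas below confirm that this group has the presentation
  \<open>\<langle>a, b | a\<^sup>n = b\<^sup>2 = 1, bab = a\<^bsup>-1\<^esup>\<rangle>\<close>.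
\<close>

definition dihedral :: "int \<Rightarrow> (bool \<times> int) monoid"
  where "dihedral n =
    \<lparr> carrier = UNIV \<times> {0..<n},
      mult = (\<lambda>(s, x) (t, y). (s \<noteq> t, ((if t then - x else x) + y) mod n)),
      one = (False, 0) \<rparr>"

definition dih_a :: "int \<Rightarrow> bool \<times> int"
  where "dih_a n = (False, 1 mod n)"

definition dih_b :: "bool \<times> int"
  where "dih_b = (True, 0)"

definition family_conditions :: "int \<Rightarrow> int \<Rightarrow> int \<Rightarrow> int \<Rightarrow> int \<Rightarrow> int \<Rightarrow> bool"
  where "family_conditions n i j k l m \<longleftrightarrow>
    ((\<forall>x\<in>{i, j, k}. 1 < x \<and> x < n) \<and> coprime i j \<and> coprime i k \<and> coprime j k) \<and>
    (\<forall>x\<in>{i, j, k}. gcd x n > 1) \<and>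
    ([l\<^sup>2 = 1] (mod n) \<and> [m\<^sup>2 = 1] (mod n) \<and>
     \<not> [l = 1] (mod n) \<and> \<not> [m = 1] (mod n) \<and> \<not> [l * m = 1] (mod n) \<and>
     [k = j * l + i] (mod n) \<and> [k = i * m + j] (mod n) \<and>
     [i * (l + 1) = 0] (mod n) \<and> [j * (m + 1) = 0] (mod n))"

definition dihedral_subset :: "int \<Rightarrow> int \<Rightarrow> int \<Rightarrow> int \<Rightarrow> (bool \<times> int) set"
  where "dihedral_subset n i j k =
    {dih_b,
     dih_b \<otimes>\<^bsub>dihedral n\<^esub> (dih_a n [^]\<^bsub>dihedral n\<^esub> i),
     dih_b \<otimes>\<^bsub>dihedral n\<^esub> (dih_a n [^]\<^bsub>dihedral n\<^esub> j),
     dih_b \<otimes>\<^bsub>dihedral n\<^esub> (dih_a n [^]\<^bsub>dihedral n\<^esub> k)}"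

definition subset_family :: "int \<Rightarrow> (bool \<times> int) set set"
  where "subset_family n =
    {C. n \<ge> 5 \<and> (\<exists>i j k l m. family_conditions n i j k l m \<and> C = dihedral_subset n i j k)}"

lemma carrier_dihedral: "carrier (dihedral n) = UNIV \<times> {0..<n}"
  by (simp add: dihedral_def)

lemma mult_dihedral:
  "(s, x) \<otimes>\<^bsub>dihedral n\<^esub> (t, y) = (s \<noteq> t, ((if t then - x else x) + y) mod n)"
  by (simp add: dihedral_def)

lemma one_dihedral: "\<one>\<^bsub>dihedral n\<^esub> = (False, 0)"
  by (simp add: dihedral_def)

lemma group_dihedral:
  assumes "n > 0"
  shows "group (dihedral n)"
proof (rule groupI)
  fix x y assume "x \<in> carrier (dihedral n)" "y \<in> carrier (dihedral n)"
  then show "x \<otimes>\<^bsub>dihedral n\<^esub> y \<in> carrier (dihedral n)"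
    using assms by (cases x; cases y) (auto simp: carrier_dihedral mult_dihedral)
next
  show "\<one>\<^bsub>dihedral n\<^esub> \<in> carrier (dihedral n)"
    using assms by (simp add: carrier_dihedral one_dihedral)
next
  fix x y z :: "bool \<times> int"
  show "x \<otimes>\<^bsub>dihedral n\<^esub> y \<otimes>\<^bsub>dihedral n\<^esub> z = x \<otimes>\<^bsub>dihedral n\<^esub> (y \<otimes>\<^bsub>dihedral n\<^esub> z)"
  proof -
    obtain s r t r' u r'' where xyz: "x = (s, r)" "y = (t, r')" "z = (u, r'')"
      by (cases x; cases y; cases z)
    show ?thesis
      unfolding xyz
      by (cases t; cases u)
        (simp_all add: mult_dihedral mod_simps, simp_all add: algebra_simps)
  qed
next
  fix x assume "x \<in> carrier (dihedral n)"
  then show "\<one>\<^bsub>dihedral n\<^esub> \<otimes>\<^bsub>dihedral n\<^esub> x = x"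
    by (cases x) (auto simp: carrier_dihedral one_dihedral mult_dihedral)
next
  fix x assume x: "x \<in> carrier (dihedral n)"
  obtain s r where sr: "x = (s, r)" by (cases x)
  show "\<exists>y\<in>carrier (dihedral n). y \<otimes>\<^bsub>dihedral n\<^esub> x = \<one>\<^bsub>dihedral n\<^esub>"
    by (rule bexI[of _ "(s, (if s then r else - r) mod n)"])
      (use assms x sr in \<open>auto simp: carrier_dihedral one_dihedral mult_dihedral mod_simps\<close>)
qed

lemma order_dihedral: "n > 0 \<Longrightarrow> order (dihedral n) = nat (2 * n)"
  by (simp add: order_def carrier_dihedral card_cartesian_product nat_mult_distrib)

lemma dih_a_carrier: "n > 0 \<Longrightarrow> dih_a n \<in> carrier (dihedral n)"
  by (simp add: dih_a_def carrier_dihedral)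

lemma dih_b_carrier: "n > 0 \<Longrightarrow> dih_b \<in> carrier (dihedral n)"
  by (simp add: dih_b_def carrier_dihedral)

lemma dih_a_pow:
  assumes "n > 0"
  shows "dih_a n [^]\<^bsub>dihedral n\<^esub> (r::int) = (False, r mod n)"
proof -
  interpret group "dihedral n" by (rule group_dihedral[OF assms])
  have nat_case: "dih_a n [^]\<^bsub>dihedral n\<^esub> (t::nat) = (False, int t mod n)" for t
    by (induction t) (auto simp: one_dihedral mult_dihedral dih_a_def mod_simps add.commute)
  have inv_eq: "inv\<^bsub>dihedral n\<^esub> (False, x mod n) = (False, - x mod n)" for x
    by (rule inv_equality)
      (use assms in \<open>auto simp: one_dihedral mult_dihedral carrier_dihedral mod_simps\<close>)
  show ?thesis
    by (auto simp: int_pow_def2 nat_case inv_eq)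
qed

lemma dih_normal_form:
  assumes "n > 0" and "(s, r) \<in> carrier (dihedral n)"
  shows "(s, r) = (if s then dih_b else \<one>\<^bsub>dihedral n\<^esub>) \<otimes>\<^bsub>dihedral n\<^esub> (dih_a n [^]\<^bsub>dihedral n\<^esub> r)"
  using assms by (auto simp: dih_a_pow one_dihedral mult_dihedral dih_b_def carrier_dihedral)

lemma dihedral_relations:
  assumes "n > 0"
  shows "dih_a n [^]\<^bsub>dihedral n\<^esub> n = \<one>\<^bsub>dihedral n\<^esub>"
    and "dih_b \<otimes>\<^bsub>dihedral n\<^esub> dih_b = \<one>\<^bsub>dihedral n\<^esub>"
    and "dih_b \<otimes>\<^bsub>dihedral n\<^esub> dih_a n \<otimes>\<^bsub>dihedral n\<^esub> dih_b = inv\<^bsub>dihedral n\<^esub> (dih_a n)"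
proof -
  interpret group "dihedral n" by (rule group_dihedral[OF assms])
  show "dih_a n [^]\<^bsub>dihedral n\<^esub> n = \<one>\<^bsub>dihedral n\<^esub>"
    by (simp add: dih_a_pow[OF assms] one_dihedral)
  show "dih_b \<otimes>\<^bsub>dihedral n\<^esub> dih_b = \<one>\<^bsub>dihedral n\<^esub>"
    by (simp add: dih_b_def mult_dihedral one_dihedral)
  show "dih_b \<otimes>\<^bsub>dihedral n\<^esub> dih_a n \<otimes>\<^bsub>dihedral n\<^esub> dih_b = inv\<^bsub>dihedral n\<^esub> (dih_a n)"
    by (rule inv_equality[symmetric])
      (use assms in \<open>auto simp: dih_a_def dih_b_def mult_dihedral one_dihedral carrier_dihedral mod_simps\<close>)
qed

lemma generate_dihedral:
  assumes "n > 0"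
  shows "generate (dihedral n) {dih_a n, dih_b} = carrier (dihedral n)"
proof -
  interpret group "dihedral n" by (rule group_dihedral[OF assms])
  let ?S = "{dih_a n, dih_b}"
  have sub: "?S \<subseteq> carrier (dihedral n)"
    using assms dih_a_carrier dih_b_carrier by auto
  have pow: "dih_a n [^]\<^bsub>dihedral n\<^esub> (t::nat) \<in> generate (dihedral n) ?S" for t
    by (induction t) (auto intro: generate.intros)
  have "(s, r) \<in> generate (dihedral n) ?S" if sr: "(s, r) \<in> carrier (dihedral n)" for s r
  proof -
    have "0 \<le> r"
      using sr by (simp add: carrier_dihedral)
    then have "dih_a n [^]\<^bsub>dihedral n\<^esub> r \<in> generate (dihedral n) ?S"
      using pow[of "nat r"] int_pow_int[of "dihedral n" "dih_a n" "nat r"] by simp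
    moreover have "(if s then dih_b else \<one>\<^bsub>dihedral n\<^esub>) \<in> generate (dihedral n) ?S"
      by (auto intro: generate.intros)
    ultimately show ?thesis
      by (subst dih_normal_form[OF assms sr]) (rule generate.eng)
  qed
  then show ?thesis
    using generate_incl[OF sub] by auto
qed

lemma (in group) conj_int_pow:
  assumes "x \<in> carrier G" "y \<in> carrier G"
  shows "y \<otimes> x [^] (r::int) \<otimes> inv y = (y \<otimes> x \<otimes> inv y) [^] r"
proof -
  have "group_hom G G (\<lambda>z. y \<otimes> z \<otimes> inv y)"
    using assms by unfold_locales (auto simp: hom_def m_assoc inv_solve_left)
  then show ?thesis
    using group_hom.hom_int_pow assms(1) by fastforce
qed

lemma dihedral_universal:
  assumes n: "n > 0" and "group H"
    and x: "x \<in> carrier H" and y: "y \<in> carrier H"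
    and xn: "x [^]\<^bsub>H\<^esub> n = \<one>\<^bsub>H\<^esub>"
    and yy: "y \<otimes>\<^bsub>H\<^esub> y = \<one>\<^bsub>H\<^esub>"
    and yxy: "y \<otimes>\<^bsub>H\<^esub> x \<otimes>\<^bsub>H\<^esub> y = inv\<^bsub>H\<^esub> x"
  shows "\<exists>h \<in> hom (dihedral n) H. h (dih_a n) = x \<and> h dih_b = y"
proof -
  interpret H: group H by fact
  have inv_y: "inv\<^bsub>H\<^esub> y = y"
    using yy y by (simp add: H.inv_equality)
  have pow_mod: "x [^]\<^bsub>H\<^esub> (r mod n) = x [^]\<^bsub>H\<^esub> r" for r
  proof -
    have "x [^]\<^bsub>H\<^esub> r = x [^]\<^bsub>H\<^esub> (n * (r div n) + r mod n)"
      by simp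
    also have "\<dots> = (x [^]\<^bsub>H\<^esub> n) [^]\<^bsub>H\<^esub> (r div n) \<otimes>\<^bsub>H\<^esub> x [^]\<^bsub>H\<^esub> (r mod n)"
      using x by (simp only: H.int_pow_mult H.int_pow_pow)
    also have "\<dots> = x [^]\<^bsub>H\<^esub> (r mod n)"
      using x by (simp add: xn)
    finally show ?thesis by simp
  qed
  have conj: "y \<otimes>\<^bsub>H\<^esub> x [^]\<^bsub>H\<^esub> r \<otimes>\<^bsub>H\<^esub> y = x [^]\<^bsub>H\<^esub> (- r)" for r :: int
    using H.conj_int_pow[OF x y, of r] x
    by (simp add: inv_y yxy H.int_pow_inv H.int_pow_neg)
  have swap: "x [^]\<^bsub>H\<^esub> r \<otimes>\<^bsub>H\<^esub> y = y \<otimes>\<^bsub>H\<^esub> x [^]\<^bsub>H\<^esub> (- r)" for r :: int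
  proof -
    have "y \<otimes>\<^bsub>H\<^esub> x [^]\<^bsub>H\<^esub> (- r) = y \<otimes>\<^bsub>H\<^esub> (y \<otimes>\<^bsub>H\<^esub> x [^]\<^bsub>H\<^esub> r \<otimes>\<^bsub>H\<^esub> y)"
      by (simp add: conj)
    also have "\<dots> = (y \<otimes>\<^bsub>H\<^esub> y) \<otimes>\<^bsub>H\<^esub> (x [^]\<^bsub>H\<^esub> r \<otimes>\<^bsub>H\<^esub> y)"
      using x y by (simp add: H.m_assoc)
    finally show ?thesis
      using x y by (simp add: yy)
  qed
  define h where "h = (\<lambda>(s, r). (if s then y else \<one>\<^bsub>H\<^esub>) \<otimes>\<^bsub>H\<^esub> x [^]\<^bsub>H\<^esub> (r::int))"
  have "h \<in> hom (dihedral n) H"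
  proof (rule homI)
    fix u assume "u \<in> carrier (dihedral n)"
    then show "h u \<in> carrier H"
      using x y by (cases u) (auto simp: h_def)
  next
    fix u v :: "bool \<times> int"
    obtain s r t r' where uv: "u = (s, r)" "v = (t, r')"
      by (cases u; cases v)
    have red: "h (s, r mod n) = h (s, r)" for s r
      by (simp add: h_def pow_mod)
    show "h (u \<otimes>\<^bsub>dihedral n\<^esub> v) = h u \<otimes>\<^bsub>H\<^esub> h v"
    proof (cases t)
      case False
      then show ?thesis
        using x y by (simp add: uv mult_dihedral red) (simp add: h_def H.int_pow_mult H.m_assoc)
    next
      case True
      have "h u \<otimes>\<^bsub>H\<^esub> h v
          = (if s then y else \<one>\<^bsub>H\<^esub>) \<otimes>\<^bsub>H\<^esub> ((x [^]\<^bsub>H\<^esub> r \<otimes>\<^bsub>H\<^esub> y) \<otimes>\<^bsub>H\<^esub> x [^]\<^bsub>H\<^esub> r')"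
        using True x y by (simp add: uv h_def H.m_assoc)
      also have "\<dots> = ((if s then y else \<one>\<^bsub>H\<^esub>) \<otimes>\<^bsub>H\<^esub> y) \<otimes>\<^bsub>H\<^esub> x [^]\<^bsub>H\<^esub> (- r + r')"
        using x y by (simp add: swap H.m_assoc H.int_pow_mult del: minus_add_distrib uminus_add_conv_diff)
      also have "\<dots> = h (\<not> s, - r + r')"
        using x y by (simp add: h_def yy)
      finally show ?thesis
        using True by (simp add: uv mult_dihedral red)
    qed
  qed
  moreover have "h (dih_a n) = x"
    using x by (simp add: h_def dih_a_def pow_mod H.int_pow_1)
  moreover have "h dih_b = y"
    using y by (simp add: h_def dih_b_def)
  ultimately show ?thesis by blast
qed

end

theory Submission
  imports Defs
begin

text \<open>
  Since \<open>q\<close> divides \<open>p + 1\<close>, \<open>n = 2 p q\<close> divides \<open>2 p (p + 1)\<close>.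
  With \<open>l = 2 p + 1\<close> we have \<open>l\<^sup>2 - 1 = 4 p (p + 1)\<close> and \<open>m \<equiv> - l\<close>, which gives all the
  congruences. The incongruences hold because \<open>q\<close> does not divide \<open>1\<close>, \<open>p\<close> does not divide
  \<open>p + 1\<close>, and \<open>l m \<equiv> -1\<close> with \<open>n > 2\<close>.
\<close>

theorem proposition4p9:
  fixes p q n i j k l m :: int
  assumes "prime p" and "odd p" and "\<not> mersenne_prime p"
    and "prime q" and "odd q" and "q dvd p + 1"
    and "n = 2 * p * q" and "i = p" and "j = q" and "k = p + q"
    and "l = 2 * p + 1" and "m = n - l"
  shows "m = 2 * p * q - 2 * p - 1 \<and>
         n \<ge> 5 \<and>
         family_conditions n i j k l m \<and>
         dihedral_subset n i j k \<in> subset_family n"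
proof -
  note defs = assms(7-12)
  have p3: "p \<ge> 3" and q3: "q \<ge> 3"
    using assms(1,2,4,5) prime_ge_2_int[of p] prime_ge_2_int[of q] by presburger+
  have key: "n dvd 2 * p * (p + 1)"
    unfolding defs using \<open>q dvd p + 1\<close> by (intro mult_dvd_mono) simp_all
  \<comment> \<open>Added together, these bound \<open>n\<close>, which is twice
    \<open>p * q\<close>, below by \<open>3 * p + 3 * q\<close>; \<open>mult.assoc\<close> then
    makes \<open>p * q\<close> an atom for linear arithmetic.\<close>
  have "3 * q \<le> p * q" "3 * p \<le> p * q"
    using p3 q3 by simp_all
  then have bounds: "p < n" "q < n" "p + q < n" "n \<ge> 5"
    using p3 q3 unfolding defs mult.assoc by linarith+
  have "\<not> p dvd 1" "\<not> q dvd 1"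
    using p3 q3 by simp_all
  then have "\<not> p dvd p + 1"
    by simp
  \<comment> \<open>If the primes were equal, \<open>p\<close> would divide its successor.\<close>
  with \<open>q dvd p + 1\<close> have "p \<noteq> q"
    by blast
  with \<open>prime p\<close> \<open>prime q\<close> have pq: "coprime p q"
    by (simp add: primes_coprime)
  have coprimes: "coprime i j" "coprime i k" "coprime j k"
    using pq gcd_add2[of q p]
    by (simp_all add: defs coprime_iff_gcd_eq_1 gcd.commute[of q p] add.commute[of q p])
  have gcds: "gcd i n > 1" "gcd j n > 1" "gcd k n > 1"
  proof -
    have gcd_gt: "gcd x n > 1" if "c dvd x" "c dvd n" "c > 1" for c x :: int
    proof -
      have "c dvd gcd x n" "gcd x n > 0"
        using that bounds p3 by (simp_all add: gcd_pos_int)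
      then show ?thesis
        using that(3) zdvd_imp_le by fastforce
    qed
    show "gcd i n > 1" "gcd j n > 1"
      using p3 q3 by (auto intro: gcd_gt[of p] gcd_gt[of q] simp: defs)
    \<comment> \<open>A sum of two odd numbers is even, so 2 is a common divisor.\<close>
    show "gcd k n > 1"
      using \<open>odd p\<close> \<open>odd q\<close> by (intro gcd_gt[of 2]) (simp_all add: defs)
  qed
  have l2: "[l\<^sup>2 = 1] (mod n)"
  proof -
    have "l\<^sup>2 - 1 = 2 * (2 * p * (p + 1))"
      by (simp add: defs power2_eq_square algebra_simps)
    with key show ?thesis
      unfolding cong_iff_dvd_diff by (simp only: dvd_mult)
  qed
  have ml: "[m = - l] (mod n)"
    by (simp add: assms(12) cong_iff_dvd_diff)
  then have m2: "[m\<^sup>2 = 1] (mod n)"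
    using l2 cong_pow[OF ml, of 2] by (auto intro: cong_trans)
  \<comment> \<open>Otherwise \<open>n\<close> divides \<open>2 * p\<close>, and cancelling
    \<open>2 * p\<close> leaves \<open>q dvd 1\<close>.\<close>
  have l1: "\<not> [l = 1] (mod n)"
    using \<open>\<not> q dvd 1\<close> p3 by (simp add: defs cong_iff_dvd_diff)
  have m1: "\<not> [m = 1] (mod n)"
  proof
    assume "[m = 1] (mod n)"
    with ml have "[- l = 1] (mod n)"
      by (metis cong_sym cong_trans)
    \<comment> \<open>The difference \<open>- l - 1\<close> is exactly this number; cancelling 2
      then makes \<open>p\<close> divide \<open>p + 1\<close>.\<close>
    then have "n dvd - (2 * (p + 1))"
      by (simp add: cong_iff_dvd_diff defs algebra_simps)
    then have "2 * (p * q) dvd 2 * (p + 1)"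
      unfolding dvd_minus_iff by (simp add: defs mult.assoc)
    then have "p * q dvd p + 1"
      by (simp only: dvd_mult_cancel_left) simp
    with \<open>\<not> p dvd p + 1\<close> show False
      using dvd_mult_left by blast
  qed
  have lm: "\<not> [l * m = 1] (mod n)"
  proof
    assume "[l * m = 1] (mod n)"
    moreover have "[l * m = - (l\<^sup>2)] (mod n)"
      using cong_mult[OF cong_refl[of l] ml] by (simp add: power2_eq_square)
    moreover have "[- (l\<^sup>2) = - 1] (mod n)"
      using l2 by (simp add: cong_minus_minus_iff)
    ultimately have "[- 1 = 1] (mod n)"
      by (metis cong_sym cong_trans)
    then have "n dvd 2"
      by (simp add: cong_iff_dvd_diff)
    with bounds show False
      using zdvd_imp_le[of n 2] by simp
  qed
  have k1: "[k = j * l + i] (mod n)"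
  proof -
    have "k - (j * l + i) = n * (- 1)"
      by (simp add: defs algebra_simps)
    then show ?thesis
      unfolding cong_iff_dvd_diff by simp
  qed
  have k2: "[k = i * m + j] (mod n)"
  proof -
    \<comment> \<open>Expanding \<open>m\<close> as \<open>n - (2 * p + 1)\<close> splits off the
      multiple \<open>n * p\<close> and leaves the number handled by \<open>key\<close>.\<close>
    have "k - (i * m + j) = 2 * p * (p + 1) - n * p"
      by (simp add: defs algebra_simps)
    with key show ?thesis
      unfolding cong_iff_dvd_diff by simp
  qed
  have il: "[i * (l + 1) = 0] (mod n)"
    using key by (simp add: cong_0_iff defs algebra_simps)
  have jm: "[j * (m + 1) = 0] (mod n)"
  proof -
    \<comment> \<open>Here \<open>m + 1\<close> equals \<open>2 * p * (q - 1)\<close>, and the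
      factor \<open>j = q\<close> completes \<open>n\<close>.\<close>
    have "j * (m + 1) = n * (q - 1)"
      by (simp add: defs algebra_simps)
    then show ?thesis
      by (simp add: cong_0_iff)
  qed
  have family: "family_conditions n i j k l m"
    unfolding family_conditions_def
    using bounds p3 q3 coprimes gcds l2 m2 l1 m1 lm k1 k2 il jm assms(8-10) by simp
  moreover have "m = 2 * p * q - 2 * p - 1"
    by (simp add: defs)
  ultimately show ?thesis
    using bounds(4) unfolding subset_family_def by blast
qed

end
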